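(* For all integers $n\ge 1$ and $m\ge 0$, $$F_{m,n}=\sum_{r=1}^{m-n+1}a_r\binom{m}{r}q^rP(F_{m-r,n-1}),$$ where an empty sum is $0$.
   Context: Let $k\ge 2$ be an integer and let $s_k(i)$ be the sum of the base-$k$ digits of $i$. Let $K$ be a field, $V$ a finite-dimensional $K$-vector space, $P\colon V\to V$ a $K$-linear map, $q\in V$, and $\zeta_k\in K$ with $\zeta_k^k=1$, $\zeta_k\neq 1$ (not necessarily primitive). Let $\mathbf u=(\mathbf u(n))_{n\ge 0}$ be the sequence in $V$ with $\mathbf u(0)=0$ and $\mathbf u(ki+j)=P(\mathbf u(i))+jq$ for all $i\ge 0$, $j=0,1,\ldots,k-1$. Let $\mathrm{Sym}(V)$ be the symmetric algebra of $V$; the $K$-algebra endomorphism of $\mathrm{Sym}(V)$ induced by $P$ is also denoted $P$. Zeroth powers equal $1$. Put $a_n=\sum_{j=0}^{k-1}j^n\zeta_k^j$ and $$F_{m,n}=\sum_{i=0}^{k^n-1}\zeta_k^{s_k(i)}\mathbf u(i)^m\in\mathrm{Sym}(V),\qquad m,n\ge 0.$$ *)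

theory Defs
  imports Complex_Main "HOL-Library.Poly_Mapping" "HOL-Library.Multiset" "HOL-Algebra.QuotRing"
begin

text \<open>
  A vector space over a field \<open>'k\<close> is given by a scalar multiplication
  \<open>scale :: 'k \<Rightarrow> 'v \<Rightarrow> 'v\<close> as in \<^locale>\<open>vector_space\<close>. Its symmetric algebra is
  presented by generators and relations. The type \<open>'v multiset \<Rightarrow>\<^sub>0 'k\<close> is the commutative
  polynomial algebra with one indeterminate for every vector (multisets are the monomials);
  \<open>Sym scale\<close> is its quotient by the ideal forcing the indeterminates to depend linearly
  on the vectors. As the ideal depends on the term \<open>scale\<close>, the quotient is a ring
  record and not a type. The lemmas below confirm the universal property.
\<close>

definition free_calg :: "('v multiset \<Rightarrow>\<^sub>0 'k::field) ring" where
  "free_calg = \<lparr>carrier = UNIV, mult = (*), one = 1, zero = 0, add = (+)\<rparr>"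

definition gen :: "'v \<Rightarrow> 'v multiset \<Rightarrow>\<^sub>0 'k::field" where
  "gen v = Poly_Mapping.single {#v#} 1"

definition const :: "'k \<Rightarrow> 'v multiset \<Rightarrow>\<^sub>0 'k::field" where
  "const c = Poly_Mapping.single {#} c"

definition sym_ideal ::
    "('k::field \<Rightarrow> 'v::ab_group_add \<Rightarrow> 'v) \<Rightarrow> ('v multiset \<Rightarrow>\<^sub>0 'k) set" where
  "sym_ideal scale = genideal free_calg
     ({gen (v + w) - gen v - gen w | v w. True} \<union>
      {gen (scale c v) - const c * gen v | c v. True})"

definition Sym ::
    "('k::field \<Rightarrow> 'v::ab_group_add \<Rightarrow> 'v) \<Rightarrow> ('v multiset \<Rightarrow>\<^sub>0 'k) set ring" where
  "Sym scale = free_calg Quot sym_ideal scale"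

definition sym_class ::
    "('k::field \<Rightarrow> 'v::ab_group_add \<Rightarrow> 'v) \<Rightarrow> ('v multiset \<Rightarrow>\<^sub>0 'k) \<Rightarrow> ('v multiset \<Rightarrow>\<^sub>0 'k) set" where
  "sym_class scale p = sym_ideal scale +>\<^bsub>free_calg\<^esub> p"

text \<open>The canonical map from the vector space to its symmetric algebra.\<close>

definition sym_inj ::
    "('k::field \<Rightarrow> 'v::ab_group_add \<Rightarrow> 'v) \<Rightarrow> 'v \<Rightarrow> ('v multiset \<Rightarrow>\<^sub>0 'k) set" where
  "sym_inj scale v = sym_class scale (gen v)"

text \<open>Scalar multiplication of the algebra \<open>Sym scale\<close>.\<close>

definition sym_scale ::
    "('k::field \<Rightarrow> 'v::ab_group_add \<Rightarrow> 'v) \<Rightarrow> 'k \<Rightarrow> ('v multiset \<Rightarrow>\<^sub>0 'k) set \<Rightarrow> ('v multiset \<Rightarrow>\<^sub>0 'k) set" where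
  "sym_scale scale c X = sym_class scale (const c) \<otimes>\<^bsub>Sym scale\<^esub> X"

text \<open>
  Evaluation of polynomials: coefficients are mapped by \<open>\<alpha>\<close>, the indeterminate of \<open>v\<close> goes
  to \<open>f v\<close>.
\<close>

definition free_lift ::
    "('k::field \<Rightarrow> 'a::comm_ring_1) \<Rightarrow> ('v \<Rightarrow> 'a) \<Rightarrow> ('v multiset \<Rightarrow>\<^sub>0 'k) \<Rightarrow> 'a" where
  "free_lift \<alpha> f p =
     (\<Sum>M\<in>Poly_Mapping.keys p. \<alpha> (Poly_Mapping.lookup p M) * (\<Prod>v\<in>#M. f v))"

text \<open>
  The algebra endomorphism of \<open>Sym scale\<close> induced by a linear map \<open>P\<close>. The union over the
  representatives of the class \<open>X\<close> is a single class, see \<open>sym_map_class\<close>.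
\<close>

definition sym_map ::
    "('k::field \<Rightarrow> 'v::ab_group_add \<Rightarrow> 'v) \<Rightarrow> ('v \<Rightarrow> 'v) \<Rightarrow>
      ('v multiset \<Rightarrow>\<^sub>0 'k) set \<Rightarrow> ('v multiset \<Rightarrow>\<^sub>0 'k) set" where
  "sym_map scale P X = (\<Union>p\<in>X. sym_class scale (free_lift const (\<lambda>v. gen (P v)) p))"

function digit_sum :: "nat \<Rightarrow> nat \<Rightarrow> nat" where
  "digit_sum k n = (if k < 2 \<or> n = 0 then 0 else n mod k + digit_sum k (n div k))"
  by auto
termination by (relation "measure snd") auto

declare digit_sum.simps [simp del]

definition a_coeff :: "nat \<Rightarrow> 'k::field \<Rightarrow> nat \<Rightarrow> 'k" where
  "a_coeff k \<zeta> n = (\<Sum>j<k. of_nat j ^ n * \<zeta> ^ j)"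

definition F ::
    "('k::field \<Rightarrow> 'v::ab_group_add \<Rightarrow> 'v) \<Rightarrow> nat \<Rightarrow> 'k \<Rightarrow> (nat \<Rightarrow> 'v) \<Rightarrow> nat \<Rightarrow> nat \<Rightarrow>
      ('v multiset \<Rightarrow>\<^sub>0 'k) set" where
  "F scale k \<zeta> u m n =
     (\<Oplus>\<^bsub>Sym scale\<^esub>i\<in>{..<k ^ n}.
        sym_scale scale (\<zeta> ^ digit_sum k i) (sym_inj scale (u i) [^]\<^bsub>Sym scale\<^esub> m))"


subsection \<open>The symmetric algebra and its universal property\<close>

lemma free_calg_simps [simp]:
  "carrier free_calg = UNIV" "x \<otimes>\<^bsub>free_calg\<^esub> y = x * y" "\<one>\<^bsub>free_calg\<^esub> = 1"
  "\<zero>\<^bsub>free_calg\<^esub> = 0" "x \<oplus>\<^bsub>free_calg\<^esub> y = x + y"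
  by (simp_all add: free_calg_def)

lemma cring_free_calg: "cring (free_calg :: ('v multiset \<Rightarrow>\<^sub>0 'k::field) ring)"
proof (rule cringI)
  show "abelian_group (free_calg :: ('v multiset \<Rightarrow>\<^sub>0 'k) ring)"
    by (rule abelian_groupI) (auto simp: algebra_simps intro: exI[of _ "- x" for x])
  show "comm_monoid (free_calg :: ('v multiset \<Rightarrow>\<^sub>0 'k) ring)"
    by (rule comm_monoidI) (auto simp: algebra_simps)
qed (auto simp: algebra_simps)

lemma ideal_sym_ideal: "ideal (sym_ideal scale) free_calg"
  unfolding sym_ideal_def by (intro ring.genideal_ideal cring.axioms(1) cring_free_calg) simp

lemma cring_Sym: "cring (Sym scale)"
  unfolding Sym_def by (rule ideal.quotient_is_cring[OF ideal_sym_ideal cring_free_calg])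

lemma sym_class_hom: "sym_class scale \<in> ring_hom free_calg (Sym scale)"
  using ideal.rcos_ring_hom[OF ideal_sym_ideal[of scale]]
  by (simp add: sym_class_def[abs_def] Sym_def)

lemma carrier_Sym: "carrier (Sym scale) = range (sym_class scale)"
  unfolding Sym_def FactRing_simps sym_class_def by (simp only: free_calg_simps) auto

lemma sym_class_eq_iff: "sym_class scale p = sym_class scale q \<longleftrightarrow> p - q \<in> sym_ideal scale"
proof -
  interpret ideal "sym_ideal scale" free_calg by (rule ideal_sym_ideal)
  have "q + (- q) = 0" by simp
  then have "\<ominus>\<^bsub>free_calg\<^esub> q = - q"
    using a_minus_def add.inv_equality[of "- q" q] by simp
  then have "p \<ominus>\<^bsub>free_calg\<^esub> q = p - q" by (simp add: a_minus_def)
  then show ?thesis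
    unfolding sym_class_def using quotient_eq_iff_same_a_r_cos[OF ideal_sym_ideal, of p q]
    by simp
qed

lemma free_lift_superset:
  assumes "\<alpha> 0 = 0" "finite A" "Poly_Mapping.keys p \<subseteq> A"
  shows "free_lift \<alpha> f p = (\<Sum>M\<in>A. \<alpha> (Poly_Mapping.lookup p M) * (\<Prod>v\<in>#M. f v))"
  unfolding free_lift_def using assms
  by (intro sum.mono_neutral_left) (auto simp: in_keys_iff)

lemma free_lift_single:
  assumes "\<alpha> 0 = 0"
  shows "free_lift \<alpha> f (Poly_Mapping.single M c) = \<alpha> c * (\<Prod>v\<in>#M. f v)"
  by (subst free_lift_superset[where A = "{M}"]) (use assms in \<open>auto\<close>)

lemma free_lift_add:
  assumes "\<alpha> 0 = 0" "\<And>c d. \<alpha> (c + d) = \<alpha> c + \<alpha> d"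
  shows "free_lift \<alpha> f (p + q) = free_lift \<alpha> f p + free_lift \<alpha> f q"
proof -
  let ?A = "Poly_Mapping.keys p \<union> Poly_Mapping.keys q"
  have "free_lift \<alpha> f r = (\<Sum>M\<in>?A. \<alpha> (Poly_Mapping.lookup r M) * (\<Prod>v\<in>#M. f v))"
    if "Poly_Mapping.keys r \<subseteq> ?A" for r
    using that by (intro free_lift_superset assms) auto
  then show ?thesis
    by (simp add: Poly_Mapping.keys_add lookup_add assms distrib_right sum.distrib)
qed

lemma poly_mapping_add_induct [case_names single add]:
  assumes "\<And>M c. Q (Poly_Mapping.single M c)" "\<And>p q. Q p \<Longrightarrow> Q q \<Longrightarrow> Q (p + q)"
  shows "Q (p :: 'b \<Rightarrow>\<^sub>0 'c::comm_monoid_add)"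
proof -
  have *: "Q (\<Sum>M\<in>A. Poly_Mapping.single M (Poly_Mapping.lookup p M))" if "finite A" for A
    using that
  proof induction
    case empty
    show ?case using assms(1)[of undefined 0] by simp
  qed (auto intro: assms)
  have "p = (\<Sum>M\<in>Poly_Mapping.keys p. Poly_Mapping.single M (Poly_Mapping.lookup p M))"
    by (rule poly_mapping_eqI)
      (auto simp: lookup_sum lookup_single when_def sum.delta in_keys_iff)
  with *[of "Poly_Mapping.keys p"] show ?thesis by simp
qed

lemma free_lift_mult:
  assumes "\<alpha> 0 = 0" "\<And>c d. \<alpha> (c + d) = \<alpha> c + \<alpha> d" "\<And>c d. \<alpha> (c * d) = \<alpha> c * \<alpha> d"
  shows "free_lift \<alpha> f (p * q) = free_lift \<alpha> f p * free_lift \<alpha> f q"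
proof (induction p rule: poly_mapping_add_induct)
  case (single M c)
  show ?case
    by (induction q rule: poly_mapping_add_induct)
      (simp_all add: mult_single free_lift_single free_lift_add assms algebra_simps)
qed (simp add: distrib_right free_lift_add assms)

lemma free_lift_diff:
  assumes "\<alpha> 0 = 0" "\<And>c d. \<alpha> (c + d) = \<alpha> c + \<alpha> d"
  shows "free_lift \<alpha> f (p - q) = free_lift \<alpha> f p - free_lift \<alpha> f q"
  using free_lift_add[of \<alpha> f "p - q" q] assms by (simp add: algebra_simps)

lemma const_hom [simp]:
  "const 0 = 0" "const 1 = 1" "const (c + d) = const c + const d" "const (c * d) = const c * const d"
  by (simp_all add: const_def single_add mult_single)

lemma free_lift_gen: "\<alpha> 0 = 0 \<Longrightarrow> \<alpha> 1 = 1 \<Longrightarrow> free_lift \<alpha> f (gen v) = f v"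
  by (simp add: gen_def free_lift_single)

lemma free_lift_const: "\<alpha> 0 = 0 \<Longrightarrow> free_lift \<alpha> f (const c) = \<alpha> c"
  by (simp add: const_def free_lift_single)

lemma sym_ideal_relations:
  "gen (v + w) - gen v - gen w \<in> sym_ideal scale"
  "gen (scale c v) - const c * gen v \<in> sym_ideal scale"
  using ring.genideal_self[OF cring.axioms(1)[OF cring_free_calg], of "
     {gen (v + w) - gen v - gen w | v w. True} \<union>
     {gen (scale c v) - const c * gen v | c v. True}"]
  unfolding sym_ideal_def by auto

lemma sym_inj_add: "sym_inj scale (v + w) = sym_inj scale v \<oplus>\<^bsub>Sym scale\<^esub> sym_inj scale w"
  using sym_ideal_relations(1)[of v w scale] ring_hom_add[OF sym_class_hom, of "gen v" "gen w" scale]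
  by (simp add: sym_inj_def sym_class_eq_iff[symmetric] diff_diff_eq)

lemma sym_inj_scale: "sym_inj scale (scale c v) = sym_scale scale c (sym_inj scale v)"
  using sym_ideal_relations(2)[of scale c v]
    ring_hom_mult[OF sym_class_hom, of "const c" "gen v" scale]
  by (simp add: sym_inj_def sym_scale_def sym_class_eq_iff[symmetric])

text \<open>Multiplicative and additive \<open>h\<close> that respect the relations kill the whole ideal.\<close>

lemma sym_ideal_subsetI:
  fixes h :: "('v::ab_group_add multiset \<Rightarrow>\<^sub>0 'k::field) \<Rightarrow> 'a::comm_ring_1"
  assumes J: "0 \<in> J" "\<And>x y. x \<in> J \<Longrightarrow> y \<in> J \<Longrightarrow> x - y \<in> J" "\<And>x y. x \<in> J \<Longrightarrow> y * x \<in> J"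
    and h: "\<And>p q. h (p + q) = h p + h q" "\<And>p q. h (p * q) = h p * h q"
    and rel: "\<And>v w. h (gen (v + w)) - h (gen v) - h (gen w) \<in> J"
      "\<And>c v. h (gen (scale c v)) - h (const c) * h (gen v) \<in> J"
    and p: "p \<in> sym_ideal scale"
  shows "h p \<in> J"
proof -
  have h_diff: "h (p - q) = h p - h q" for p q
    using h(1)[of "p - q" q] by (simp add: algebra_simps)
  have h0: "h 0 = 0" using h(1)[of 0 0] by simp
  have uminus: "- x \<in> J" if "x \<in> J" for x using J(2)[OF J(1) that] by simp
  have add: "x + y \<in> J" if "x \<in> J" "y \<in> J" for x y
    using J(2)[OF that(1) uminus[OF that(2)]] by simp
  have J3: "x * y \<in> J" if "x \<in> J" for x y
    using J(3)[OF that, of y] by (simp add: mult.commute)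
  interpret R: cring "free_calg :: ('v multiset \<Rightarrow>\<^sub>0 'k) ring" by (rule cring_free_calg)
  have inv: "inv\<^bsub>add_monoid free_calg\<^esub> x = - x" for x :: "'v multiset \<Rightarrow>\<^sub>0 'k"
  proof -
    have "\<ominus>\<^bsub>free_calg\<^esub> x = - x" using R.add.inv_equality[of "- x" x] by simp
    then show ?thesis unfolding a_inv_def .
  qed
  have "ideal {p. h p \<in> J} free_calg"
  proof (rule idealI)
    show "subgroup {p. h p \<in> J} (add_monoid free_calg)"
      by unfold_locales (use inv h_diff[of 0] h0 in \<open>auto simp: h J add uminus\<close>)
  qed (auto simp: h R.ring_axioms J(3) J3)
  then have "sym_ideal scale \<subseteq> {p. h p \<in> J}"
    unfolding sym_ideal_def by (rule R.genideal_minimal) (auto simp: h h_diff rel)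
  with p show ?thesis by auto
qed

text \<open>
  Linear maps into a commutative algebra (with structure map \<open>\<alpha>\<close>) extend uniquely to the
  symmetric algebra.
\<close>

theorem Sym_universal:
  fixes \<alpha> :: "'k::field \<Rightarrow> 'a::comm_ring_1" and f :: "'v::ab_group_add \<Rightarrow> 'a"
  assumes \<alpha>: "\<alpha> 1 = 1" "\<And>c d. \<alpha> (c + d) = \<alpha> c + \<alpha> d" "\<And>c d. \<alpha> (c * d) = \<alpha> c * \<alpha> d"
    and f: "\<And>v w. f (v + w) = f v + f w" "\<And>c v. f (scale c v) = \<alpha> c * f v"
  shows "\<exists>!h. h \<in> extensional (carrier (Sym scale)) \<and>
    h \<in> ring_hom (Sym scale) \<lparr>carrier = UNIV, mult = (*), one = 1, zero = 0, add = (+)\<rparr> \<and>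
    (\<forall>c. h (sym_class scale (const c)) = \<alpha> c) \<and> (\<forall>v. h (sym_inj scale v) = f v)"
    (is "\<exists>!h. ?Q h")
proof -
  have \<alpha>0: "\<alpha> 0 = 0" using \<alpha>(2)[of 0 0] by simp
  note \<alpha> = \<alpha>0 \<alpha>
  let ?l = "free_lift \<alpha> f"
  note l = free_lift_add[of \<alpha> f, OF \<alpha>(1,3)] free_lift_mult[of \<alpha> f, OF \<alpha>(1,3,4)]
  have ker: "?l p = 0" if "p \<in> sym_ideal scale" for p
    using sym_ideal_subsetI[of "{0}" ?l scale p] that
    by (auto simp: l free_lift_gen free_lift_const \<alpha> f)
  define h where "h = (\<lambda>X\<in>carrier (Sym scale). ?l (SOME p. sym_class scale p = X))"
  have h: "h (sym_class scale p) = ?l p" for p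
  proof -
    have "sym_class scale (SOME q. sym_class scale q = sym_class scale p) = sym_class scale p"
      by (rule someI) simp
    then have "?l ((SOME q. sym_class scale q = sym_class scale p) - p) = 0"
      using ker unfolding sym_class_eq_iff by blast
    then have "?l (SOME q. sym_class scale q = sym_class scale p) = ?l p"
      using free_lift_diff[of \<alpha> f, OF \<alpha>(1,3)] by simp
    then show ?thesis by (simp add: h_def carrier_Sym)
  qed
  have "?Q h"
  proof (intro conjI)
    show "h \<in> extensional (carrier (Sym scale))" by (simp add: h_def)
    have "?l 1 = 1" using free_lift_const[of \<alpha> f 1] \<alpha> by simp
    then show "h \<in> ring_hom (Sym scale) \<lparr>carrier = UNIV, mult = (*), one = 1, zero = 0, add = (+)\<rparr>"
      using ring_hom_add[OF sym_class_hom, of _ _ scale, symmetric]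
        ring_hom_mult[OF sym_class_hom, of _ _ scale, symmetric]
        ring_hom_one[OF sym_class_hom, of scale, symmetric]
      by (intro ring_hom_memI) (auto simp: carrier_Sym h l)
  qed (simp_all add: h sym_inj_def free_lift_gen free_lift_const \<alpha>)
  moreover have "g = h" if g: "?Q g" for g
  proof (rule extensionalityI)
    fix X assume "X \<in> carrier (Sym scale)"
    then obtain p where X: "X = sym_class scale p" by (auto simp: carrier_Sym)
    let ?g = "\<lambda>p. g (sym_class scale p)"
    have hom: "?g (p + q) = ?g p + ?g q" "?g (p * q) = ?g p * ?g q" for p q
      using g ring_hom_add[OF sym_class_hom, of p q scale]
        ring_hom_mult[OF sym_class_hom, of p q scale]
      by (auto simp: ring_hom_def carrier_Sym)
    have "?g (Poly_Mapping.single M c) = ?l (Poly_Mapping.single M c)" for M c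
    proof (induction M)
      case empty
      then show ?case using g by (simp add: free_lift_const \<alpha> flip: const_def)
    next
      case (add v M)
      have "Poly_Mapping.single (add_mset v M) c = gen v * Poly_Mapping.single M c"
        by (simp add: gen_def mult_single)
      then show ?case using add g by (simp add: hom l free_lift_gen \<alpha> sym_inj_def)
    qed
    then have "?g p = ?l p"
      by (induction p rule: poly_mapping_add_induct) (simp_all add: hom l)
    then show "g X = h X" by (simp add: X h)
  qed (use g in \<open>simp_all add: h_def\<close>)
  ultimately show ?thesis by blast
qed

lemma sym_map_class:
  assumes "Vector_Spaces.linear scale scale P"
  shows "sym_map scale P (sym_class scale p) =
    sym_class scale (free_lift const (\<lambda>v. gen (P v)) p)"
proof -
  interpret Vector_Spaces.linear scale scale P by fact
  interpret I: ideal "sym_ideal scale" free_calg by (rule ideal_sym_ideal)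
  let ?l = "free_lift const (\<lambda>v. gen (P v))"
  have gen: "?l (gen v) = gen (P v)" for v by (rule free_lift_gen) simp_all
  have "?l q \<in> sym_ideal scale" if "q \<in> sym_ideal scale" for q
  proof (rule sym_ideal_subsetI[OF _ _ _ _ _ _ _ that])
    fix x y assume xy: "x \<in> sym_ideal scale" "y \<in> sym_ideal scale"
    have "- 1 * y \<in> sym_ideal scale"
      using I.I_l_closed[OF xy(2), of "- 1"] by simp
    then show "x - y \<in> sym_ideal scale"
      using additive_subgroup.a_closed[OF I.additive_subgroup_axioms xy(1), of "- y"] by simp
  next
    fix x y assume "x \<in> sym_ideal scale"
    then show "y * x \<in> sym_ideal scale" using I.I_l_closed[of x y] by simp
  next
    show "0 \<in> sym_ideal scale" using additive_subgroup.zero_closed[OF I.additive_subgroup_axioms] by simp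
  qed (use sym_ideal_relations[where scale = scale] in
      \<open>simp_all add: free_lift_add free_lift_mult gen free_lift_const add scale\<close>)
  then have "sym_class scale (?l q) = sym_class scale (?l p)" if q: "q \<in> sym_class scale p" for q
  proof -
    obtain i where "i \<in> sym_ideal scale" "q = i + p"
      using q unfolding sym_class_def a_r_coset_def' by auto
    then show ?thesis
      using \<open>\<And>q. q \<in> sym_ideal scale \<Longrightarrow> ?l q \<in> sym_ideal scale\<close>
      by (simp add: sym_class_eq_iff free_lift_add)
  qed
  moreover have "p \<in> sym_class scale p"
    unfolding sym_class_def by (rule I.a_rcos_self) simp
  ultimately show ?thesis unfolding sym_map_def by blast
qed

lemma sym_map_hom:
  fixes scale :: "'k::field \<Rightarrow> 'v::ab_group_add \<Rightarrow> 'v"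
  assumes "Vector_Spaces.linear scale scale P"
  shows "sym_map scale P \<in> ring_hom (Sym scale) (Sym scale)"
    and "sym_map scale P (sym_class scale (const c)) = sym_class scale (const c)"
    and "sym_map scale P (sym_inj scale v) = sym_inj scale (P v)"
proof -
  have "free_lift const (\<lambda>v. gen (P v)) (1 :: 'v multiset \<Rightarrow>\<^sub>0 'k) = 1"
    using free_lift_const[of const _ 1] by simp
  then show "sym_map scale P \<in> ring_hom (Sym scale) (Sym scale)"
    using ring_hom_add[OF sym_class_hom, of _ _ scale, symmetric]
      ring_hom_mult[OF sym_class_hom, of _ _ scale, symmetric]
      ring_hom_one[OF sym_class_hom, of scale, symmetric]
    by (intro ring_hom_memI)
      (auto simp: carrier_Sym sym_map_class[OF assms] free_lift_add free_lift_mult)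
qed (simp_all add: sym_inj_def sym_map_class[OF assms] free_lift_gen free_lift_const)

end

theory Submission
  imports Defs
begin

text \<open>
  Write \<open>i < k ^ Suc n\<close> as \<open>k * i' + j\<close> with \<open>j < k\<close>. The digit sum then splits as
  \<open>j + digit_sum k i'\<close>, and \<open>u i\<close> is \<open>P (u i') + j q\<close>. Expanding
  the power \<open>(P (u i') + j q) ^ m\<close> by the binomial theorem and summing over \<open>j\<close> first collects the
  coefficient \<open>a\<^sub>r = \<Sum>j. j ^ r * \<zeta> ^ j\<close> of \<open>q ^ r\<close>, while the sum over \<open>i'\<close> is the image under
  \<open>P\<close> of \<open>F\<close> at \<open>(m - r, n)\<close>. This gives a recursion in which \<open>r\<close> runs from \<open>0\<close> to \<open>m\<close>
  (\<open>F_recursion\<close>).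

  The two ends of this range contribute nothing. At \<open>r = 0\<close> the coefficient is the full geometric
  sum \<open>a\<^sub>0 = (\<zeta> ^ k - 1) / (\<zeta> - 1) = 0\<close>. As every remaining step lowers the exponent by at least
  one, induction on \<open>n\<close> shows that \<open>F\<close> vanishes at \<open>(m, n)\<close> whenever \<open>m < n\<close>
  (\<open>F_eq_zero\<close>), which removes the terms with \<open>m - r < n - 1\<close>.

  The calculations are made with representatives in the commutative polynomial algebra, where the
  usual laws of sums and powers are available; \<open>sym_class\<close> is a homomorphism onto the symmetric
  algebra, so the defining ideal enters only where the indeterminate of \<open>P (u i') + j q\<close> is
  replaced by the corresponding combination of indeterminates.
\<close>

section \<open>Representatives of elements of the symmetric algebra\<close>

lemma sym_class_add:
  "sym_class scale (p + q) = sym_class scale p \<oplus>\<^bsub>Sym scale\<^esub> sym_class scale q"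
  using ring_hom_add[OF sym_class_hom, of p q scale] by simp

lemma sym_class_mult:
  "sym_class scale (p * q) = sym_class scale p \<otimes>\<^bsub>Sym scale\<^esub> sym_class scale q"
  using ring_hom_mult[OF sym_class_hom, of p q scale] by simp

lemma sym_class_one: "sym_class scale 1 = \<one>\<^bsub>Sym scale\<^esub>"
  using ring_hom_one[OF sym_class_hom, of scale] by simp

lemma sym_class_zero: "sym_class scale 0 = \<zero>\<^bsub>Sym scale\<^esub>"
  using ring_hom_zero[OF sym_class_hom cring.axioms(1)[OF cring_free_calg]
      cring.axioms(1)[OF cring_Sym], of scale] by simp

lemma sym_class_closed: "sym_class scale p \<in> carrier (Sym scale)"
  by (simp add: carrier_Sym)

lemma sym_class_power: "sym_class scale (p ^ n) = sym_class scale p [^]\<^bsub>Sym scale\<^esub> n"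
proof -
  interpret S: cring "Sym scale" by (rule cring_Sym)
  show ?thesis
    by (induction n)
      (simp_all add: sym_class_one sym_class_mult S.m_comm sym_class_closed)
qed

lemma sym_class_sum:
  "finite A \<Longrightarrow> sym_class scale (sum f A) = (\<Oplus>\<^bsub>Sym scale\<^esub>i\<in>A. sym_class scale (f i))"
proof (induction A rule: finite_induct)
  case empty
  interpret S: cring "Sym scale" by (rule cring_Sym)
  show ?case by (simp add: sym_class_zero)
next
  case (insert x A)
  interpret S: cring "Sym scale" by (rule cring_Sym)
  from insert show ?case
    by (simp add: sym_class_add sym_class_closed Pi_iff)
qed

lemma sym_scale_class: "sym_scale scale c (sym_class scale p) = sym_class scale (const c * p)"
  by (simp add: sym_scale_def sym_class_mult)

lemma const_of_nat: "const (of_nat n) = of_nat n"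
  by (induction n) simp_all

lemma const_power: "const (c ^ n) = const c ^ n"
  by (induction n) simp_all

lemma const_sum: "const (sum f A) = (\<Sum>x\<in>A. const (f x))"
  by (induction A rule: infinite_finite_induct) simp_all

text \<open>
  A representative of \<open>F\<close> in the polynomial algebra, where sums and powers are those of a
  commutative ring type. As \<open>u\<close> is an argument, the action of \<open>P\<close> amounts to replacing \<open>u\<close>
  by \<open>\<lambda>i. P (u i)\<close> (\<open>free_lift_F_poly\<close>).
\<close>

definition F_poly ::
    "nat \<Rightarrow> 'k::field \<Rightarrow> (nat \<Rightarrow> 'v) \<Rightarrow> nat \<Rightarrow> nat \<Rightarrow> 'v multiset \<Rightarrow>\<^sub>0 'k" where
  "F_poly k \<zeta> u m n = (\<Sum>i<k ^ n. const (\<zeta> ^ digit_sum k i) * gen (u i) ^ m)"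

lemma F_eq_class: "F scale k \<zeta> u m n = sym_class scale (F_poly k \<zeta> u m n)"
  by (simp add: F_def F_poly_def sym_class_sum sym_inj_def sym_scale_class flip: sym_class_power)

lemma free_lift_F_poly:
  fixes P :: "'v \<Rightarrow> 'v" and \<zeta> :: "'k::field"
  shows
  "free_lift const (\<lambda>v. gen (P v)) (F_poly k \<zeta> u m n) = F_poly k \<zeta> (\<lambda>i. P (u i)) m n"
proof -
  let ?l = "free_lift const (\<lambda>v. gen (P v)) :: ('v multiset \<Rightarrow>\<^sub>0 'k) \<Rightarrow> _"
  have one: "?l 1 = 1" using free_lift_const[of const _ 1] by simp
  have pow: "?l (p ^ e) = ?l p ^ e" for p e
    by (induction e) (simp_all add: one free_lift_mult)
  have "?l (sum f A) = (\<Sum>i\<in>A. ?l (f i))" if "finite A" for f and A :: "nat set"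
    using that
    by (induction A rule: finite_induct) (simp_all add: free_lift_add free_lift_def[of _ _ 0])
  then show ?thesis
    by (simp add: F_poly_def free_lift_mult free_lift_const free_lift_gen pow)
qed

section \<open>Splitting off the last digit\<close>

lemma digit_sum_mult_add:
  assumes "k \<ge> 2" "j < k"
  shows "digit_sum k (k * i + j) = j + digit_sum k i"
proof (cases "k * i + j = 0")
  case True
  then show ?thesis using assms by (simp add: digit_sum.simps)
next
  case False
  then show ?thesis using assms by (subst digit_sum.simps) auto
qed

lemma sum_lessThan_mult:
  fixes f :: "nat \<Rightarrow> 'a::comm_monoid_add"
  shows "(\<Sum>i<k * N. f i) = (\<Sum>i<N. \<Sum>j<k. f (k * i + j))"
proof -
  have "sum f {i * k..<i * k + k} = (\<Sum>j<k. f (k * i + j))" for i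
    using sum.shift_bounds_nat_ivl[of f 0 "i * k" k]
    by (simp add: atLeast0LessThan algebra_simps)
  then show ?thesis
    using sum.nat_group[of f k N] by (simp add: mult.commute)
qed

text \<open>
  The binomial theorem, with the two sums interchanged: the power of \<open>j\<close> joins the weight \<open>\<zeta> ^ j\<close>
  to form \<open>a_coeff\<close>.
\<close>

lemma sum_digit_binomial:
  "(\<Sum>j<k. const (\<zeta> ^ j) * (x + of_nat j * y) ^ m) =
    (\<Sum>r\<le>m. const (a_coeff k \<zeta> r * of_nat (m choose r)) * (y ^ r * x ^ (m - r)))"
proof -
  have "(x + of_nat j * y) ^ m =
      (\<Sum>r\<le>m. const (of_nat j ^ r * of_nat (m choose r)) * (y ^ r * x ^ (m - r)))" for j
  proof -
    have "(x + of_nat j * y) ^ m = (of_nat j * y + x) ^ m" by (simp add: add.commute)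
    then show ?thesis
      by (simp add: binomial_ring const_of_nat const_power power_mult_distrib mult_ac)
  qed
  then have "(\<Sum>j<k. const (\<zeta> ^ j) * (x + of_nat j * y) ^ m) =
      (\<Sum>j<k. \<Sum>r\<le>m. const (of_nat j ^ r * \<zeta> ^ j) *
        (const (of_nat (m choose r)) * (y ^ r * x ^ (m - r))))"
    by (simp add: sum_distrib_left mult_ac)
  also have "\<dots> = (\<Sum>r\<le>m. \<Sum>j<k. const (of_nat j ^ r * \<zeta> ^ j) *
        (const (of_nat (m choose r)) * (y ^ r * x ^ (m - r))))"
    by (rule sum.swap)
  also have "\<dots> = (\<Sum>r\<le>m. const (a_coeff k \<zeta> r * of_nat (m choose r)) * (y ^ r * x ^ (m - r)))"
    by (simp add: a_coeff_def const_sum sum_distrib_right mult.assoc)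
  finally show ?thesis .
qed

text \<open>
  Summation over the last digit, before the vanishing terms are discarded. At each index
  \<open>k * i + j\<close> the class of the indeterminate \<open>u (k * i + j)\<close> is replaced by that of
  \<open>P (u i) + j q\<close>; from there on the identity holds between polynomials, before passing to
  the quotient.
\<close>

lemma F_recursion:
  fixes scale :: "'k::field \<Rightarrow> 'v::ab_group_add \<Rightarrow> 'v"
  assumes k: "k \<ge> 2"
    and P: "Vector_Spaces.linear scale scale P"
    and u: "\<And>i j. j < k \<Longrightarrow> u (k * i + j) = P (u i) + scale (of_nat j) q"
  shows "F scale k \<zeta> u m (Suc n) =
    (\<Oplus>\<^bsub>Sym scale\<^esub>r\<in>{..m}.
       sym_scale scale (a_coeff k \<zeta> r * of_nat (m choose r))
         (sym_inj scale q [^]\<^bsub>Sym scale\<^esub> r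
            \<otimes>\<^bsub>Sym scale\<^esub> sym_map scale P (F scale k \<zeta> u (m - r) n)))"
proof -
  let ?cl = "sym_class scale"
  let ?x = "\<lambda>i. gen (P (u i)) :: 'v multiset \<Rightarrow>\<^sub>0 'k"
  let ?y = "gen q :: 'v multiset \<Rightarrow>\<^sub>0 'k"
  have gen_u: "?cl (gen (u (k * i + j))) = ?cl (?x i + of_nat j * ?y)" if "j < k" for i j
    using u[OF that, of i]
      sym_inj_add[of scale "P (u i)" "scale (of_nat j) q"] sym_inj_scale[of scale "of_nat j" q]
    by (simp add: sym_inj_def sym_class_add sym_scale_class const_of_nat)
  have split: "F scale k \<zeta> u m (Suc n) =
      ?cl (\<Sum>i<k ^ n. \<Sum>j<k. const (\<zeta> ^ digit_sum k (k * i + j)) * gen (u (k * i + j)) ^ m)"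
    by (simp add: F_eq_class F_poly_def sum_lessThan_mult)
  let ?b = "\<Sum>i<k ^ n. \<Sum>j<k.
      const (\<zeta> ^ digit_sum k (k * i + j)) * (?x i + of_nat j * ?y) ^ m"
  note split
  also have "?cl (\<Sum>i<k ^ n. \<Sum>j<k. const (\<zeta> ^ digit_sum k (k * i + j)) * gen (u (k * i + j)) ^ m)
      = ?cl ?b"
  proof -
    interpret S: cring "Sym scale" by (rule cring_Sym)
    show ?thesis
      \<comment> \<open>The two polynomials differ; only the classes of the innermost generators agree.\<close>
      unfolding sym_class_sum[OF finite_lessThan] sym_class_mult sym_class_power
      by (intro S.finsum_cong')
        (auto simp: gen_u sym_class_closed simp flip: sym_class_sum sym_class_mult sym_class_power)
  qed
  also have "?b = (\<Sum>i<k ^ n. const (\<zeta> ^ digit_sum k i) *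
      (\<Sum>j<k. const (\<zeta> ^ j) * (?x i + of_nat j * ?y) ^ m))"
    by (simp add: digit_sum_mult_add[OF k] power_add sum_distrib_left mult.assoc mult.left_commute)
  also have "\<dots> = (\<Sum>r\<le>m. const (a_coeff k \<zeta> r * of_nat (m choose r)) *
      (?y ^ r * F_poly k \<zeta> (\<lambda>i. P (u i)) (m - r) n))"
    unfolding sum_digit_binomial F_poly_def sum_distrib_left
    by (subst sum.swap) (simp add: mult_ac)
  finally show ?thesis
    by (simp add: sym_class_sum F_eq_class sym_map_class[OF P] free_lift_F_poly sym_inj_def
        sym_scale_class flip: sym_class_power sym_class_mult)
qed

section \<open>Vanishing terms\<close>

lemma a_coeff_0:
  assumes "\<zeta> ^ k = 1" "\<zeta> \<noteq> 1"
  shows "a_coeff k \<zeta> 0 = 0"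
  using geometric_sum[OF assms(2), of k] assms(1) by (simp add: a_coeff_def)

lemma F_closed: "F scale k \<zeta> u m n \<in> carrier (Sym scale)"
  by (simp add: F_eq_class sym_class_closed)

lemma sym_scale_0: "X \<in> carrier (Sym scale) \<Longrightarrow> sym_scale scale 0 X = \<zero>\<^bsub>Sym scale\<^esub>"
  by (auto simp: carrier_Sym sym_scale_class sym_class_zero)

lemma sym_scale_zero: "sym_scale scale c \<zero>\<^bsub>Sym scale\<^esub> = \<zero>\<^bsub>Sym scale\<^esub>"
  using sym_scale_class[of scale c 0] by (simp add: sym_class_zero)

lemma sym_scale_closed:
  "X \<in> carrier (Sym scale) \<Longrightarrow> sym_scale scale c X \<in> carrier (Sym scale)"
  by (auto simp: carrier_Sym sym_scale_class)

text \<open>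
  Summing over one digit kills the terms free of \<open>q\<close>, so each of the \<open>n\<close> digits uses up at least
  one of the \<open>m\<close> factors of \<open>u i ^ m\<close>.
\<close>

lemma F_eq_zero:
  fixes scale :: "'k::field \<Rightarrow> 'v::ab_group_add \<Rightarrow> 'v"
  assumes k: "k \<ge> 2"
    and P: "Vector_Spaces.linear scale scale P"
    and \<zeta>: "\<zeta> ^ k = 1" "\<zeta> \<noteq> 1"
    and u: "\<And>i j. j < k \<Longrightarrow> u (k * i + j) = P (u i) + scale (of_nat j) q"
    and "m < n"
  shows "F scale k \<zeta> u m n = \<zero>\<^bsub>Sym scale\<^esub>"
  using \<open>m < n\<close>
proof (induction n arbitrary: m)
  case 0
  then show ?case by simp
next
  case (Suc n)
  interpret S: cring "Sym scale" by (rule cring_Sym)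
  interpret h: ring_hom_cring "Sym scale" "Sym scale" "sym_map scale P"
    by (intro ring_hom_cring.intro ring_hom_cring_axioms.intro cring_Sym sym_map_hom[OF P])
  have q: "sym_inj scale q \<in> carrier (Sym scale)" by (simp add: sym_inj_def sym_class_closed)
  let ?t = "\<lambda>r. sym_scale scale (a_coeff k \<zeta> r * of_nat (m choose r))
    (sym_inj scale q [^]\<^bsub>Sym scale\<^esub> r
      \<otimes>\<^bsub>Sym scale\<^esub> sym_map scale P (F scale k \<zeta> u (m - r) n))"
  have t: "?t r = \<zero>\<^bsub>Sym scale\<^esub>" if "r \<le> m" for r
  proof (cases "r = 0")
    case True
    then show ?thesis by (simp add: a_coeff_0[OF \<zeta>] sym_scale_0 F_closed)
  next
    case False
    with that Suc.prems have "m - r < n" by simp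
    then show ?thesis by (simp add: Suc.IH sym_scale_zero q)
  qed
  have "F scale k \<zeta> u m (Suc n) = (\<Oplus>\<^bsub>Sym scale\<^esub>r\<in>{..m}. ?t r)"
    by (rule F_recursion[OF k P u])
  also have "\<dots> = \<zero>\<^bsub>Sym scale\<^esub>"
    by (rule S.add.finprod_one_eqI) (simp add: t)
  finally show ?case .
qed

theorem theorem2p5:
  fixes k :: nat
    and scale :: "'k::field \<Rightarrow> 'v::ab_group_add \<Rightarrow> 'v"
    and Basis :: "'v set"
    and P :: "'v \<Rightarrow> 'v"
    and q :: 'v
    and \<zeta> :: 'k
    and u :: "nat \<Rightarrow> 'v"
    and m n :: nat
  assumes "k \<ge> 2"
    and "finite_dimensional_vector_space scale Basis"
    and "Vector_Spaces.linear scale scale P"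
    and "\<zeta> ^ k = 1" and "\<zeta> \<noteq> 1"
    and "u 0 = 0"
    and "\<And>i j. j < k \<Longrightarrow> u (k * i + j) = P (u i) + scale (of_nat j) q"
    and "n \<ge> 1"
  shows "F scale k \<zeta> u m n =
    (\<Oplus>\<^bsub>Sym scale\<^esub>r\<in>{1..m + 1 - n}.
       sym_scale scale (a_coeff k \<zeta> r * of_nat (m choose r))
         (sym_inj scale q [^]\<^bsub>Sym scale\<^esub> r
            \<otimes>\<^bsub>Sym scale\<^esub> sym_map scale P (F scale k \<zeta> u (m - r) (n - 1))))"
proof -
  interpret S: cring "Sym scale" by (rule cring_Sym)
  interpret h: ring_hom_cring "Sym scale" "Sym scale" "sym_map scale P"
    by (intro ring_hom_cring.intro ring_hom_cring_axioms.intro cring_Sym sym_map_hom[OF assms(3)])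
  have q: "sym_inj scale q \<in> carrier (Sym scale)" by (simp add: sym_inj_def sym_class_closed)
  obtain l where n: "n = Suc l" using \<open>n \<ge> 1\<close> by (cases n) auto
  let ?t = "\<lambda>r. sym_scale scale (a_coeff k \<zeta> r * of_nat (m choose r))
    (sym_inj scale q [^]\<^bsub>Sym scale\<^esub> r
      \<otimes>\<^bsub>Sym scale\<^esub> sym_map scale P (F scale k \<zeta> u (m - r) l))"
  have "F scale k \<zeta> u m n = (\<Oplus>\<^bsub>Sym scale\<^esub>r\<in>{..m}. ?t r)"
    unfolding n by (rule F_recursion[OF assms(1,3,7)])
  also have "\<dots> = (\<Oplus>\<^bsub>Sym scale\<^esub>r\<in>{1..m + 1 - n}. ?t r)"
  proof (rule S.add.finprod_mono_neutral_cong_right)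
    fix r assume r: "r \<in> {..m} - {1..m + 1 - n}"
    show "?t r = \<zero>\<^bsub>Sym scale\<^esub>"
    proof (cases "r = 0")
      case True
      then show ?thesis by (simp add: a_coeff_0[OF assms(4,5)] sym_scale_0 F_closed)
    next
      case False
      with r n have "m - r < l" by auto
      then have "F scale k \<zeta> u (m - r) l = \<zero>\<^bsub>Sym scale\<^esub>"
        by (intro F_eq_zero[OF assms(1,3-5)]) (use assms(7) in auto)
      then show ?thesis by (simp add: sym_scale_zero q)
    qed
  qed (use n in \<open>auto intro!: sym_scale_closed simp: q F_closed\<close>)
  finally show ?thesis by (simp add: n)
qed

end
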